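(* Let $H$ be a separable real Hilbert space with orthonormal basis $\{e_i:i\in\mathbb{N}\}$. Let $A=\{a_{ij}:i,j\in\mathbb{N}\}$ be a double sequence of real numbers with $\sum_{i,j}a_{ij}^2<\infty$, and let $T:H\to H$ be the operator defined, for $x\in H$, by $$Tx=(\langle x,e_1\rangle,\langle x,e_2\rangle,\ldots)\,A\begin{pmatrix} e_1 \\ e_2 \\ \vdots \end{pmatrix}=\sum_{j=1}^{\infty}\sum_{i=1}^{\infty}a_{ij}\langle x,e_i\rangle e_j .$$ Then $T$ has the following properties. (i) $T:H\to H$ is a linear and continuous Hilbert-Schmidt operator on $H$, and its Hilbert-Schmidt norm satisfies $\|T\|_{HS}^2=\sum_{i=1}^{\infty}\sum_{j=1}^{\infty}a_{ij}^2$. (ii) $T$ is Fréchet differentiable on $H$ with $\nabla T(z)=T$ for any $z\in H$. (iii) $T$ is Mordukhovich differentiable on $H$ with $\widehat{D}^*T(z)=T^*$ for any $z\in H$. Here $T^*$ is the adjoint operator of $T$, which is defined by the transpose $A^T$, that is, $T^*y=(\langle y,e_1\rangle,\langle y,e_2\rangle,\ldots)\,A^T\begin{pmatrix} e_1 \\ e_2 \\ \vdots \end{pmatrix}$ for $y\in H$. (iv) The covering constant of $T$ is constant with $\hat{\alpha}(T,\bar{x},\bar{y})=0$ for any $\bar{x},\bar{y}\in H$ with $\bar{y}=T\bar{x}$.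
   Context: $\langle\cdot,\cdot\rangle$ and $\|\cdot\|_H$ are the inner product and norm of $H$; $\mathbb{B}(x,\eta)$ is the closed ball with center $x$ and radius $\eta$. A linear continuous operator $T:H\to H$ is a Hilbert-Schmidt operator if $\sum_{i=1}^{\infty}\|Te_i\|_H^2<\infty$; its Hilbert-Schmidt norm is given by $\|T\|_{HS}^2=\sum_{i=1}^{\infty}\|Te_i\|_H^2$. $\nabla g(\bar{x})$ denotes the Fréchet derivative of $g$ at $\bar{x}$, a continuous linear map $H\to H$. For a continuous single-valued $g:H\to H$ and $x,y\in H$, the Mordukhovich derivative (coderivative) of $g$ at $x$ is the set-valued mapping $$\widehat{D}^*g(x)(y)=\left\{z\in H:\ \limsup_{u\to x}\frac{\langle z,u-x\rangle-\langle y,g(u)-g(x)\rangle}{\|u-x\|_H+\|g(u)-g(x)\|_H}\le 0\right\},$$ and $g$ is Mordukhovich differentiable at $x$ if $\widehat{D}^*g(x)(y)\ne\emptyset$ for every $y\in H$. When the value is a singleton it is identified with its element: $\widehat{D}^*g(x)=L$ for a map $L$ means $\widehat{D}^*g(x)(y)=\{L(y)\}$ for all $y\in H$. For $\bar{x},\bar{y}\in H$ with $\bar{y}=g(\bar{x})$, the covering constant is $$\hat{\alpha}(g,\bar{x},\bar{y})=\sup_{\eta>0}\inf\{\|z\|_H:\ z\in\widehat{D}^*g(x)(w),\ x\in\mathbb{B}(\bar{x},\eta),\ g(x)\in\mathbb{B}(\bar{y},\eta),\ \|w\|_H=1\}.$$ *)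

theory Defs
  imports "HOL-Analysis.Analysis"
begin

definition orthonormal_basis :: "(nat \<Rightarrow> 'a::real_inner) \<Rightarrow> bool" where
  "orthonormal_basis e \<longleftrightarrow>
     (\<forall>i j. e i \<bullet> e j = (if i = j then 1 else 0)) \<and> closure (span (range e)) = UNIV"

text \<open>The operator given by a row vector of coordinates times the infinite matrix \<open>a\<close> times the
  column of basis vectors. Both sums are norm limits of partial sums; \<^const>\<open>suminf\<close> is unspecified
  where they diverge, so convergence has to be asserted separately.\<close>

definition matrix_operator ::
    "(nat \<Rightarrow> 'a::real_inner) \<Rightarrow> (nat \<Rightarrow> nat \<Rightarrow> real) \<Rightarrow> 'a \<Rightarrow> 'a" where
  "matrix_operator e a x = (\<Sum>j. \<Sum>i. (a i j * (x \<bullet> e i)) *\<^sub>R e j)"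

definition matrix_series_converges ::
    "(nat \<Rightarrow> 'a::real_inner) \<Rightarrow> (nat \<Rightarrow> nat \<Rightarrow> real) \<Rightarrow> 'a \<Rightarrow> bool" where
  "matrix_series_converges e a x \<longleftrightarrow>
     (\<forall>j. summable (\<lambda>i. (a i j * (x \<bullet> e i)) *\<^sub>R e j)) \<and>
     summable (\<lambda>j. \<Sum>i. (a i j * (x \<bullet> e i)) *\<^sub>R e j)"

definition hilbert_schmidt :: "(nat \<Rightarrow> 'a::real_inner) \<Rightarrow> ('a \<Rightarrow> 'a) \<Rightarrow> bool" where
  "hilbert_schmidt e T \<longleftrightarrow> bounded_linear T \<and> summable (\<lambda>i. (norm (T (e i)))\<^sup>2)"

definition hs_norm :: "(nat \<Rightarrow> 'a::real_inner) \<Rightarrow> ('a \<Rightarrow> 'a) \<Rightarrow> real" where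
  "hs_norm e T = sqrt (\<Sum>i. (norm (T (e i)))\<^sup>2)"

definition coderivative :: "('a::real_inner \<Rightarrow> 'a) \<Rightarrow> 'a \<Rightarrow> 'a \<Rightarrow> 'a set" where
  "coderivative g x y =
     {z. Limsup (at x) (\<lambda>u. ereal ((z \<bullet> (u - x) - y \<bullet> (g u - g x)) /
                                 (norm (u - x) + norm (g u - g x)))) \<le> 0}"

definition mordukhovich_differentiable :: "('a::real_inner \<Rightarrow> 'a) \<Rightarrow> 'a \<Rightarrow> bool" where
  "mordukhovich_differentiable g x \<longleftrightarrow> (\<forall>y. coderivative g x y \<noteq> {})"

text \<open>Extended-real valued: the infimum of the empty set is \<open>\<infinity>\<close>, and the supremum over
  \<open>\<eta>\<close> may be infinite.\<close>

definition covering_constant :: "('a::real_inner \<Rightarrow> 'a) \<Rightarrow> 'a \<Rightarrow> 'a \<Rightarrow> ereal" where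
  "covering_constant g xbar ybar =
     (SUP \<eta>\<in>{0<..}. Inf {ereal (norm z) | z x w.
        z \<in> coderivative g x w \<and> x \<in> cball xbar \<eta> \<and> g x \<in> cball ybar \<eta> \<and> norm w = 1})"

end

theory Submission
  imports Defs
begin

text \<open>Let \<open>r j = \<Sum>i. a i j *\<^sub>R e i\<close> be the vector given by column \<open>j\<close> of the matrix; it exists by
  the Riesz-Fischer argument and \<open>(norm (r j))\<^sup>2\<close> is the square sum of the column. The operator is
  then \<open>T x = (\<Sum>j. (x \<bullet> r j) *\<^sub>R e j)\<close>, and all estimates reduce to the Cauchy-Schwarz inequality.
  The coderivative of a bounded linear map is its adjoint, as one sees by testing the defining limit
  along rays, and the covering constant vanishes because \<open>norm (T\<^sup>* (e n))\<close> is a null sequence for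
  the Hilbert-Schmidt operator \<open>T\<^sup>*\<close>.\<close>

section \<open>Orthonormal series\<close>

lemma orthonormal_basis_inner:
  "orthonormal_basis e \<Longrightarrow> e i \<bullet> e j = (if i = j then 1 else 0)"
  by (simp add: orthonormal_basis_def)

lemma orthonormal_basis_norm: "orthonormal_basis e \<Longrightarrow> norm (e i) = 1"
  by (simp add: norm_eq_sqrt_inner orthonormal_basis_inner)

lemma norm_sum_orthonormal:
  assumes "orthonormal_basis e" "finite I"
  shows "(norm (\<Sum>i\<in>I. c i *\<^sub>R e i))\<^sup>2 = (\<Sum>i\<in>I. (c i)\<^sup>2)"
proof -
  have "pairwise (\<lambda>i j. orthogonal (c i *\<^sub>R e i) (c j *\<^sub>R e j)) I"
    by (auto simp: pairwise_def orthogonal_def orthonormal_basis_inner[OF assms(1)])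
  from norm_sum_Pythagorean[OF assms(2) this] show ?thesis
    by (simp add: orthonormal_basis_norm[OF assms(1)])
qed

text \<open>Stated for \<open>complete_space\<close> because the sort \<open>{real_inner, polish_space}\<close> is not
  recognized as a subsort of \<open>banach\<close>.\<close>

lemma orthonormal_series_summable:
  fixes e :: "nat \<Rightarrow> 'a::{real_inner, complete_space}"
  assumes basis: "orthonormal_basis e" and c: "summable (\<lambda>i. (c i)\<^sup>2)"
  shows "summable (\<lambda>i. c i *\<^sub>R e i)"
proof -
  let ?S = "\<lambda>n. \<Sum>i<n. c i *\<^sub>R e i"
  have "Cauchy ?S"
  proof (rule CauchyI')
    fix d :: real
    assume "d > 0"
    then have "d\<^sup>2 > 0" by simp
    \<comment> \<open>The Cauchy criterion is used at \<open>d\<^sup>2\<close> because a block of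
      the series has as its squared norm the block of squared coefficients.\<close>
    with c obtain N where N: "\<And>m n. m \<ge> N \<Longrightarrow> norm (\<Sum>i=m..<n. (c i)\<^sup>2) < d\<^sup>2"
      unfolding summable_Cauchy by blast
    have "dist (?S m) (?S n) < d" if "m \<ge> N" "m < n" for m n
    proof -
      have "?S n - ?S m = (\<Sum>i=m..<n. c i *\<^sub>R e i)"
        using sum_diff_nat_ivl[of 0 m n "\<lambda>i. c i *\<^sub>R e i"] that by (simp add: atLeast0LessThan)
      then have "(norm (?S n - ?S m))\<^sup>2 < d\<^sup>2"
        using N[OF that(1), of n] by (simp add: norm_sum_orthonormal[OF basis])
      then have "norm (?S n - ?S m) < d"
        using \<open>d > 0\<close> by (simp add: power2_less_imp_less)
      then show ?thesis
        by (simp add: dist_norm norm_minus_commute)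
    qed
    then show "\<exists>M. \<forall>m\<ge>M. \<forall>n>m. dist (?S m) (?S n) < d"
      by blast
  qed
  then have "convergent ?S"
    by (rule Cauchy_convergent)
  then show ?thesis
    by (simp add: summable_iff_convergent)
qed

lemma orthonormal_series_inner:
  assumes basis: "orthonormal_basis e" and y: "(\<lambda>i. c i *\<^sub>R e i) sums y"
  shows "y \<bullet> e k = c k"
proof -
  have "(\<lambda>i. (c i *\<^sub>R e i) \<bullet> e k) sums (y \<bullet> e k)"
    by (rule bounded_linear.sums[OF bounded_linear_inner_left y])
  moreover have "(\<lambda>i. (c i *\<^sub>R e i) \<bullet> e k) = (\<lambda>i. if i = k then c i else 0)"
    by (auto simp: orthonormal_basis_inner[OF basis])
  ultimately show ?thesis
    using sums_single[of k c] sums_unique2 by metis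
qed

text \<open>Parseval's identity: pairing the series with \<open>y\<close> itself gives the terms
  \<open>c i * (y \<bullet> e i)\<close>, which are squares since
  \<open>y \<bullet> e i = c i\<close>.\<close>

lemma orthonormal_series_norm:
  assumes basis: "orthonormal_basis e" and y: "(\<lambda>i. c i *\<^sub>R e i) sums y"
  shows "(\<lambda>i. (c i)\<^sup>2) sums (norm y)\<^sup>2"
  using bounded_linear.sums[OF bounded_linear_inner_right[of y] y]
  by (simp add: orthonormal_series_inner[OF assms] power2_norm_eq_inner flip: power2_eq_square)

section \<open>Operators given by square summable matrices\<close>

text \<open>The Riesz representative of the functional that sends \<open>x\<close> to coordinate
  \<open>j\<close> of \<open>matrix_operator e a x\<close>.\<close>

definition matrix_column :: "(nat \<Rightarrow> 'a::real_inner) \<Rightarrow> (nat \<Rightarrow> nat \<Rightarrow> real) \<Rightarrow> nat \<Rightarrow> 'a" where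
  "matrix_column e a j = (\<Sum>i. a i j *\<^sub>R e i)"

text \<open>Fubini for unordered sums; it leads from summability over pairs to the ordered iterated
  series in which norms are expressed.\<close>

lemma square_summable_iterated:
  fixes b :: "nat \<Rightarrow> nat \<Rightarrow> real"
  assumes "(\<lambda>(i, j). (b i j)\<^sup>2) summable_on UNIV"
  shows "summable (\<lambda>j. (b i j)\<^sup>2)" "summable (\<lambda>i. \<Sum>j. (b i j)\<^sup>2)"
proof -
  have *: "(\<lambda>(i, j). (b i j)\<^sup>2) summable_on Sigma UNIV (\<lambda>_. UNIV)"
    using assms by simp
  have row: "(\<lambda>j. (b i j)\<^sup>2) summable_on UNIV" for i
    using summable_on_SigmaD1[OF *] by simp
  then show "summable (\<lambda>j. (b i j)\<^sup>2)" for i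
    by (rule summable_on_imp_summable)
  have "infsum (\<lambda>j. (b i j)\<^sup>2) UNIV = (\<Sum>j. (b i j)\<^sup>2)" for i
    using has_sum_imp_sums[OF has_sum_infsum[OF row]] sums_unique by blast
  moreover have "(\<lambda>i. infsum (\<lambda>j. (b i j)\<^sup>2) UNIV) summable_on UNIV"
    using summable_on_Sigma_banach[OF *] by simp
  ultimately show "summable (\<lambda>i. \<Sum>j. (b i j)\<^sup>2)"
    by (simp add: summable_on_imp_summable)
qed

context
  fixes e :: "nat \<Rightarrow> 'a::{real_inner, complete_space}" and a :: "nat \<Rightarrow> nat \<Rightarrow> real"
  assumes basis: "orthonormal_basis e"
    and square_summable: "(\<lambda>(i, j). (a i j)\<^sup>2) summable_on UNIV"
begin

text \<open>Through this symmetry facts about rows also serve for columns, and the results of this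
  context also hold for the transposed matrix, which yields the adjoint.\<close>

lemma transpose_square_summable: "(\<lambda>(i, j). (a j i)\<^sup>2) summable_on UNIV"
  using square_summable summable_on_swap[of "\<lambda>(i, j). (a i j)\<^sup>2" UNIV UNIV] by simp

lemmas column_square_summable = square_summable_iterated[OF transpose_square_summable]

lemma matrix_column_sums: "(\<lambda>i. a i j *\<^sub>R e i) sums matrix_column e a j"
  unfolding matrix_column_def
  by (intro summable_sums orthonormal_series_summable[OF basis] column_square_summable)

lemma matrix_column_inner: "matrix_column e a j \<bullet> e i = a i j"
  by (rule orthonormal_series_inner[OF basis matrix_column_sums])

lemma matrix_column_norm: "(norm (matrix_column e a j))\<^sup>2 = (\<Sum>i. (a i j)\<^sup>2)"
  using orthonormal_series_norm[OF basis matrix_column_sums] sums_unique by blast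

text \<open>Continuity of the inner product collapses the inner series of the operator to a single
  coefficient.\<close>

lemma matrix_entry_sums:
  "(\<lambda>i. (a i j * (x \<bullet> e i)) *\<^sub>R e j) sums ((x \<bullet> matrix_column e a j) *\<^sub>R e j)"
  using bounded_linear.sums[OF bounded_linear_inner_right[of x] matrix_column_sums]
  by (intro sums_scaleR_left) simp

lemma inner_column_square_le:
  "(x \<bullet> matrix_column e a j)\<^sup>2 \<le> (norm x)\<^sup>2 * (\<Sum>i. (a i j)\<^sup>2)"
  using Cauchy_Schwarz_ineq[of x "matrix_column e a j"]
  by (simp flip: matrix_column_norm add: power2_norm_eq_inner)

text \<open>The square sums of the columns, scaled by \<open>(norm x)\<^sup>2\<close>, form a
  summable majorant, so the outer series converges as an orthonormal series.\<close>

lemma inner_column_square_summable: "summable (\<lambda>j. (x \<bullet> matrix_column e a j)\<^sup>2)"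
  by (rule summable_comparison_test'[OF summable_mult[OF column_square_summable(2)]])
    (use inner_column_square_le in simp)

lemma matrix_operator_sums:
  "(\<lambda>j. (x \<bullet> matrix_column e a j) *\<^sub>R e j) sums matrix_operator e a x"
  unfolding matrix_operator_def sums_unique[OF matrix_entry_sums, symmetric]
  by (intro summable_sums orthonormal_series_summable[OF basis] inner_column_square_summable)

lemma matrix_series_convergent: "matrix_series_converges e a x"
  unfolding matrix_series_converges_def sums_unique[OF matrix_entry_sums, symmetric]
  using matrix_entry_sums matrix_operator_sums sums_summable by blast

lemma matrix_operator_inner: "matrix_operator e a x \<bullet> e j = x \<bullet> matrix_column e a j"
  by (rule orthonormal_series_inner[OF basis matrix_operator_sums])

text \<open>Parseval's identity followed by Cauchy-Schwarz in each coordinate: the Hilbert-Schmidt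
  norm bounds the operator norm.\<close>

lemma matrix_operator_norm_le:
  "(norm (matrix_operator e a x))\<^sup>2 \<le> (norm x)\<^sup>2 * (\<Sum>j. \<Sum>i. (a i j)\<^sup>2)"
proof -
  have "(norm (matrix_operator e a x))\<^sup>2 = (\<Sum>j. (x \<bullet> matrix_column e a j)\<^sup>2)"
    by (rule sums_unique[OF orthonormal_series_norm[OF basis matrix_operator_sums]])
  also have "\<dots> \<le> (\<Sum>j. (norm x)\<^sup>2 * (\<Sum>i. (a i j)\<^sup>2))"
    by (intro suminf_le inner_column_square_le inner_column_square_summable summable_mult
        column_square_summable)
  finally show ?thesis
    by (simp add: suminf_mult column_square_summable)
qed

lemma bounded_linear_matrix_operator: "bounded_linear (matrix_operator e a)"
proof (rule bounded_linear_intro)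
  fix x y :: 'a and c :: real
  have "(\<lambda>j. ((x + y) \<bullet> matrix_column e a j) *\<^sub>R e j) sums
      (matrix_operator e a x + matrix_operator e a y)"
    using sums_add[OF matrix_operator_sums[of x] matrix_operator_sums[of y]]
    by (simp add: inner_add_left scaleR_add_left)
  then show "matrix_operator e a (x + y) = matrix_operator e a x + matrix_operator e a y"
    using matrix_operator_sums sums_unique2 by blast
  have "(\<lambda>j. ((c *\<^sub>R x) \<bullet> matrix_column e a j) *\<^sub>R e j) sums (c *\<^sub>R matrix_operator e a x)"
    using sums_scaleR_right[OF matrix_operator_sums[of x], of c] by simp
  then show "matrix_operator e a (c *\<^sub>R x) = c *\<^sub>R matrix_operator e a x"
    using matrix_operator_sums sums_unique2 by blast
  show "norm (matrix_operator e a x) \<le> norm x * sqrt (\<Sum>j. \<Sum>i. (a i j)\<^sup>2)"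
    using real_le_rsqrt[OF matrix_operator_norm_le[of x]] by (simp add: real_sqrt_mult)
qed

text \<open>The coordinates of the image of \<open>e i\<close> form row \<open>i\<close> of the
  matrix, so this is Parseval's identity.\<close>

lemma matrix_operator_basis_norm:
  "(norm (matrix_operator e a (e i)))\<^sup>2 = (\<Sum>j. (a i j)\<^sup>2)"
  using orthonormal_series_norm[OF basis matrix_operator_sums[of "e i"]] sums_unique
  by (simp add: inner_commute[of "e i"] matrix_column_inner)

lemma hilbert_schmidt_matrix_operator: "hilbert_schmidt e (matrix_operator e a)"
  by (simp add: hilbert_schmidt_def bounded_linear_matrix_operator matrix_operator_basis_norm
      square_summable_iterated[OF square_summable])

lemma hs_norm_matrix_operator: "(hs_norm e (matrix_operator e a))\<^sup>2 = (\<Sum>i. \<Sum>j. (a i j)\<^sup>2)"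
  by (simp add: hs_norm_def matrix_operator_basis_norm suminf_nonneg
      square_summable_iterated[OF square_summable])

end

section \<open>Transposed matrices and adjoints\<close>

text \<open>The set where two continuous linear maps agree is closed and contains the span of the
  basis, which is dense.\<close>

lemma bounded_linear_eq_on_basis:
  assumes "orthonormal_basis e" "bounded_linear f" "bounded_linear g" "\<And>i. f (e i) = g (e i)"
  shows "f x = g x"
proof -
  have "closed {x. f x = g x}"
    by (intro closed_Collect_eq linear_continuous_on assms(2,3))
  moreover have "span (range e) \<subseteq> {x. f x = g x}"
    using linear_eq_on_span[of f g "range e"] assms by (auto intro: bounded_linear.linear)
  ultimately have "closure (span (range e)) \<subseteq> {x. f x = g x}"
    by (simp add: closure_minimal)
  then show ?thesis
    using assms(1) by (auto simp: orthonormal_basis_def)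
qed

text \<open>Both sides are bounded linear in \<open>y\<close>, so it suffices to compare them at the
  basis vectors.\<close>

lemma matrix_operator_transpose_inner:
  fixes e :: "nat \<Rightarrow> 'a::{real_inner, complete_space}"
  assumes basis: "orthonormal_basis e"
    and square_summable: "(\<lambda>(i, j). (a i j)\<^sup>2) summable_on UNIV"
  shows "matrix_operator e a x \<bullet> y = x \<bullet> matrix_operator e (\<lambda>i j. a j i) y"
proof (rule bounded_linear_eq_on_basis[OF basis, where x = y
      and f = "\<lambda>y. matrix_operator e a x \<bullet> y"
      and g = "\<lambda>y. x \<bullet> matrix_operator e (\<lambda>i j. a j i) y"])
  note tr = transpose_square_summable[OF basis square_summable]
  show "bounded_linear (\<lambda>y. matrix_operator e a x \<bullet> y)"
    by (rule bounded_linear_inner_right)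
  show "bounded_linear (\<lambda>y. x \<bullet> matrix_operator e (\<lambda>i j. a j i) y)"
    by (rule bounded_linear_inner_right_comp[OF bounded_linear_matrix_operator[OF basis tr]])
  have col: "matrix_column e (\<lambda>i j. a j i) i \<bullet> e j = a i j" for i j
    by (rule matrix_column_inner[OF basis tr])
  fix j
  \<comment> \<open>Both vectors are the limit of the same orthonormal series with coefficients
    \<open>a i j\<close>.\<close>
  have "matrix_operator e (\<lambda>i j. a j i) (e j) = matrix_column e a j"
    using matrix_operator_sums[OF basis tr, of "e j"] matrix_column_sums[OF basis square_summable]
    by (simp add: inner_commute[of "e j"] col sums_unique2)
  then show "matrix_operator e a x \<bullet> e j = x \<bullet> matrix_operator e (\<lambda>i j. a j i) (e j)"
    by (simp add: matrix_operator_inner[OF basis square_summable])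
qed

section \<open>Coderivatives and covering constants of linear operators\<close>

text \<open>The numerator of the quotient is \<open>(z - S y) \<bullet> (u - x)\<close>. It vanishes
  for \<open>z = S y\<close>; otherwise the quotient is a positive constant along the ray from
  \<open>x\<close> in direction \<open>z - S y\<close>.\<close>

lemma coderivative_linear:
  fixes T S :: "'a::real_inner \<Rightarrow> 'a"
  assumes "linear T" and adj: "\<And>x y. T x \<bullet> y = x \<bullet> S y"
  shows "coderivative T x y = {S y}"
proof -
  have num: "z \<bullet> (u - x) - y \<bullet> (T u - T x) = (z - S y) \<bullet> (u - x)" for z u
  proof -
    have "y \<bullet> (T u - T x) = S y \<bullet> (u - x)"
      using adj[of "u - x" y] by (metis inner_commute linear_diff[OF \<open>linear T\<close>])
    then show ?thesis
      by (simp only: inner_diff_left)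
  qed
  have "z = S y" if z: "z \<in> coderivative T x y" for z
  proof (rule ccontr)
    assume "z \<noteq> S y"
    define v where "v = z - S y"
    with \<open>z \<noteq> S y\<close> have v: "norm v > 0" by simp
    \<comment> \<open>By homogeneity this is the value of the quotient at
      \<open>x + t *\<^sub>R v\<close> for every \<open>t > 0\<close>.\<close>
    define q where "q = (norm v)\<^sup>2 / (norm v + norm (T v))"
    have "q > 0"
      unfolding q_def using v by (intro divide_pos_pos add_pos_nonneg) auto
    let ?f = "\<lambda>u. (v \<bullet> (u - x)) / (norm (u - x) + norm (T u - T x))"
    have "Limsup (at x) (\<lambda>u. ereal (?f u)) \<le> 0"
      using z by (simp add: coderivative_def num v_def)
    also have "0 < ereal q"
      using \<open>q > 0\<close> by simp
    finally have "\<forall>\<^sub>F u in at x. ereal (?f u) < ereal q"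
      by (rule Limsup_lessD)
    \<comment> \<open>The ray approaches \<open>x\<close> without meeting it, so the bound near
      \<open>x\<close> can be pulled back to small positive \<open>t\<close>.\<close>
    moreover have "filterlim (\<lambda>t. x + t *\<^sub>R v) (at x) (at_right 0)"
      unfolding filterlim_at
    proof
      show "\<forall>\<^sub>F t in at_right 0. x + t *\<^sub>R v \<in> UNIV \<and> x + t *\<^sub>R v \<noteq> x"
        using v by (auto simp: eventually_at_right_less eventually_at_filter)
      have "((\<lambda>t. x + t *\<^sub>R v) \<longlongrightarrow> x + 0 *\<^sub>R v) (at_right 0)"
        by (intro tendsto_intros)
      then show "((\<lambda>t. x + t *\<^sub>R v) \<longlongrightarrow> x) (at_right 0)"
        by simp
    qed
    ultimately have "\<forall>\<^sub>F t in at_right 0. ?f (x + t *\<^sub>R v) < q"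
      by (auto simp: filterlim_iff)
    moreover have "\<forall>\<^sub>F t::real in at_right 0. t > 0"
      by (rule eventually_at_right_less)
    ultimately have "\<forall>\<^sub>F t::real in at_right 0. False"
    proof eventually_elim
      case (elim t)
      have "T (x + t *\<^sub>R v) - T x = t *\<^sub>R T v"
        by (simp add: linear_add[OF \<open>linear T\<close>] linear_scale[OF \<open>linear T\<close>])
      then have "?f (x + t *\<^sub>R v) = (t * (norm v)\<^sup>2) / (t * (norm v + norm (T v)))"
        using elim(2) by (simp add: power2_norm_eq_inner algebra_simps)
      also have "\<dots> = q"
        using elim(2) by (simp add: q_def)
      finally show False
        using elim(1) by simp
    qed
    then show False
      by simp
  qed
  moreover have "S y \<in> coderivative T x y"
    by (auto simp: coderivative_def num intro!: Limsup_bounded)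
  ultimately show ?thesis
    by blast
qed

text \<open>The center \<open>x\<close> lies in every ball, so the elements \<open>z n\<close>
  compete in the infimum for each radius and force it down to 0; norms keep it nonnegative.\<close>

lemma covering_constant_eq_0:
  fixes g :: "'a::real_inner \<Rightarrow> 'a"
  assumes w: "\<And>n. norm (w n) = 1" and z: "\<And>n. z n \<in> coderivative g x (w n)"
    and lim: "(\<lambda>n. norm (z n)) \<longlonglongrightarrow> 0"
  shows "covering_constant g x (g x) = 0"
proof -
  let ?A = "\<lambda>\<eta>. {ereal (norm z) | z u w.
      z \<in> coderivative g u w \<and> u \<in> cball x \<eta> \<and> g u \<in> cball (g x) \<eta> \<and> norm w = 1}"
  have "Inf (?A \<eta>) = 0" if "\<eta> > 0" for \<eta> :: real
  proof (rule antisym)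
    have "Inf (?A \<eta>) \<le> ereal (norm (z n))" for n
      using w z that by (intro Inf_lower CollectI exI[of _ "z n"] exI[of _ x] exI[of _ "w n"]) simp
    moreover have "(\<lambda>n. ereal (norm (z n))) \<longlonglongrightarrow> 0"
      using tendsto_ereal[OF lim] by (simp only: zero_ereal_def)
    ultimately show "Inf (?A \<eta>) \<le> 0"
      by (intro tendsto_lowerbound) auto
    show "0 \<le> Inf (?A \<eta>)"
      by (auto intro!: Inf_greatest)
  qed
  then show ?thesis
    \<comment> \<open>A supremum of the constant 0 is 0 because the set of positive radii is
      nonempty.\<close>
    unfolding covering_constant_def by (subst SUP_cong[OF refl, where D = "\<lambda>_. 0"]) auto
qed

theorem theorem4p1:
  fixes e :: "nat \<Rightarrow> 'a::{real_inner, polish_space}"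
    and a :: "nat \<Rightarrow> nat \<Rightarrow> real"
    and T :: "'a \<Rightarrow> 'a"
  assumes basis: "orthonormal_basis e"
    and square_summable: "(\<lambda>(i, j). (a i j)\<^sup>2) summable_on UNIV"
    and T: "T = matrix_operator e a"
  shows "(\<forall>x. matrix_series_converges e a x) \<and>
         (hilbert_schmidt e T \<and> (hs_norm e T)\<^sup>2 = (\<Sum>i. \<Sum>j. (a i j)\<^sup>2)) \<and>
         (\<forall>z. (T has_derivative T) (at z)) \<and>
         ((\<forall>z. mordukhovich_differentiable T z) \<and>
          (\<forall>z y. coderivative T z y = {adjoint T y}) \<and>
          (\<forall>x y. T x \<bullet> y = x \<bullet> adjoint T y) \<and>
          (\<forall>y. matrix_series_converges e (\<lambda>i j. a j i) y) \<and>
          (\<forall>y. adjoint T y = matrix_operator e (\<lambda>i j. a j i) y)) \<and>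
         (\<forall>xbar ybar. ybar = T xbar \<longrightarrow> covering_constant T xbar ybar = 0)"
proof -
  let ?S = "matrix_operator e (\<lambda>i j. a j i)"
  note tr = transpose_square_summable[OF basis square_summable]
  have bl: "bounded_linear T"
    unfolding T by (rule bounded_linear_matrix_operator[OF basis square_summable])
  have inner: "T x \<bullet> y = x \<bullet> ?S y" for x y
    unfolding T by (rule matrix_operator_transpose_inner[OF basis square_summable])
  \<comment> \<open>\<open>adjoint\<close> is a choice among maps satisfying the adjoint identity,
    so exhibiting \<open>?S\<close> as one such map determines it.\<close>
  have adj: "adjoint T = ?S"
    by (rule adjoint_unique) (simp add: inner)
  have cod: "coderivative T z y = {?S y}" for z y
    by (rule coderivative_linear[OF bounded_linear.linear[OF bl] inner])
  \<comment> \<open>The transposed operator is Hilbert-Schmidt too, so its values at the unit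
    vectors \<open>e n\<close> tend to 0; these values are the coderivatives at
    \<open>e n\<close>.\<close>
  have "summable (\<lambda>n. (norm (?S (e n)))\<^sup>2)"
    using hilbert_schmidt_matrix_operator[OF basis tr] by (simp add: hilbert_schmidt_def)
  from summable_LIMSEQ_zero[OF this] have "(\<lambda>n. norm (?S (e n))) \<longlonglongrightarrow> 0"
    by (simp add: power_tendsto_0_iff)
  then have cov: "covering_constant T x (T x) = 0" for x
    by (rule covering_constant_eq_0[rotated 2])
      (simp_all add: cod orthonormal_basis_norm[OF basis])
  show ?thesis
    using matrix_series_convergent[OF basis square_summable] matrix_series_convergent[OF basis tr]
      hilbert_schmidt_matrix_operator[OF basis square_summable]
      hs_norm_matrix_operator[OF basis square_summable]
      bounded_linear_imp_has_derivative[OF bl] cod cov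
    by (simp add: T[symmetric] adj inner mordukhovich_differentiable_def)
qed

end
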